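(* Let $n\ge 1$, $r=2n+1$, let $\mathbf{m}_1,\dots,\mathbf{m}_r\in\mathbb{C}^{n+1}$ be nonzero vectors, let $A=\{P_i=[\mathbf{m}_i]\}_{i=1}^r\subset\mathbb{P}^n$, and let $T=\sum_{i=1}^r\nu_4(\mathbf{m}_i)\in S^4\mathbb{C}^{n+1}$. Suppose that the following three tests are successful: 1) (minimality test) $\dim\langle\nu_4(\mathbf{m}_1),\dots,\nu_4(\mathbf{m}_r)\rangle=r$; 2) (Kruskal's test) $A$ is in linear general position; 3) (Terracini's test) $\dim\langle \mathrm{T}_{\mathbf{m}_1}\nu_4(\mathbb{C}^{n+1}),\dots,\mathrm{T}_{\mathbf{m}_r}\nu_4(\mathbb{C}^{n+1})\rangle=2n^2+3n+1$. Then $T$ has (complex symmetric) rank $r$ and is identifiable: the set $\{\nu_4(\mathbf{m}_1),\dots,\nu_4(\mathbf{m}_r)\}$ is the unique set of $r$ symmetric rank-1 tensors with sum $T$.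
   Context: $\mathbb{P}^n=\mathbb{P}(\mathbb{C}^{n+1})$. Here $\nu_4:\mathbb{C}^{n+1}\to S^4\mathbb{C}^{n+1}\cong\mathbb{C}^{\binom{n+4}{4}}$ is the 4-fold symmetric tensor power $\mathbf{m}\mapsto\mathbf{m}\otimes\mathbf{m}\otimes\mathbf{m}\otimes\mathbf{m}$ and $\langle\cdot\rangle$ denotes the linear (vector-space) span, with vector-space dimension. The symmetric rank-1 tensors are the nonzero tensors of the form $\nu_4(\mathbf{m})$ with $\mathbf{m}\in\mathbb{C}^{n+1}$ (over $\mathbb{C}$, scalar multiples are of this form too). The symmetric rank of $T$ is the minimal number of symmetric rank-1 tensors with sum $T$; $T$ is identifiable if its decomposition as a sum of this minimal number of symmetric rank-1 tensors is unique up to reordering of the summands (the summands being considered as tensors). $\mathrm{T}_{\mathbf{m}}\nu_4(\mathbb{C}^{n+1})$ is the tangent space, as a linear subspace of $S^4\mathbb{C}^{n+1}$, to the affine cone over the Veronese variety at the point $\nu_4(\mathbf{m})$, i.e. the image of the derivative of $\nu_4$ at $\mathbf{m}$; identifying vectors with linear forms, it is $\{\mathbf{m}^3\mathbf{v}:\mathbf{v}\in\mathbb{C}^{n+1}\}$. A finite set $A\subset\mathbb{P}^n$ of cardinality $\ell(A)$ is in linear general position if every subset of $A$ of cardinality at most $\min\{\ell(A),n+1\}$ is linearly independent. *)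

theory Defs
  imports "HOL-Analysis.Analysis" "HOL-Library.Multiset"
begin

text \<open>
  Fourth-order tensors over \<open>\<complex>\<^sup>N\<close>, \<open>N = CARD('n)\<close>, are vectors indexed by quadruples, so that
  linear algebra over \<open>\<complex>\<close> is that of the interpretation \<open>vec\<close> (scalar multiplication \<open>*s\<close>).
  The symmetric tensors form a linear subspace containing every tensor considered here; spans
  and dimensions are the same in the ambient space.
\<close>

type_synonym 'n tensor4 = "complex ^ ('n \<times> 'n \<times> 'n \<times> 'n)"

definition tensor4 ::
  "complex ^ 'n \<Rightarrow> complex ^ 'n \<Rightarrow> complex ^ 'n \<Rightarrow> complex ^ 'n \<Rightarrow> ('n::finite) tensor4" where
  "tensor4 a b c d = (\<chi> p. case p of (i, j, k, l) \<Rightarrow> a $ i * b $ j * c $ k * d $ l)"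

definition veronese4 :: "complex ^ 'n \<Rightarrow> ('n::finite) tensor4" where
  "veronese4 m = tensor4 m m m m"

definition sym_rank1_tensors :: "('n::finite) tensor4 set" where
  "sym_rank1_tensors = {t. t \<noteq> 0 \<and> (\<exists>m. t = veronese4 m)}"

text \<open>
  Decompositions are multisets: summands are unordered and may a priori be repeated.
\<close>

definition sym_decomposition :: "('n::finite) tensor4 multiset \<Rightarrow> 'n tensor4 \<Rightarrow> bool" where
  "sym_decomposition M T \<longleftrightarrow> set_mset M \<subseteq> sym_rank1_tensors \<and> \<Sum>\<^sub># M = T"

text \<open>
  Meaningful for symmetric tensors, which always have a decomposition; otherwise unspecified.
\<close>

definition sym_rank :: "('n::finite) tensor4 \<Rightarrow> nat" where
  "sym_rank T = (LEAST k. \<exists>M. sym_decomposition M T \<and> size M = k)"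

definition identifiable :: "('n::finite) tensor4 \<Rightarrow> bool" where
  "identifiable T \<longleftrightarrow> (\<exists>!M. sym_decomposition M T \<and> size M = sym_rank T)"

text \<open>
  The derivative below is taken over \<open>\<real>\<close>; as \<open>veronese4\<close> is polynomial, it is
  \<open>\<complex>\<close>-linear and is the complex derivative (see \<open>veronese_tangent_eq\<close>).
\<close>

definition veronese_tangent :: "complex ^ 'n \<Rightarrow> ('n::finite) tensor4 set" where
  "veronese_tangent m = range (frechet_derivative veronese4 (at m))"

lemma veronese4_has_derivative:
  fixes m :: "complex ^ 'n::finite"
  shows "(veronese4 has_derivative
     (\<lambda>v. tensor4 v m m m + tensor4 m v m m + tensor4 m m v m + tensor4 m m m v)) (at m)"
proof (subst has_derivative_componentwise_within, intro ballI)
  fix b :: "'n tensor4"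
  assume "b \<in> Basis"
  then obtain p c where b: "b = axis p c" by (auto simp: Basis_vec_def)
  obtain i j k l where p: "p = (i, j, k, l)" by (cases p) auto
  have nth: "((\<lambda>x::complex^'n. x $ a) has_derivative (\<lambda>x. x $ a)) (at m)" for a
    by (rule bounded_linear_imp_has_derivative[OF bounded_linear_vec_nth])
  have "((\<lambda>x. (x $ i * x $ j * x $ k * x $ l) \<bullet> c) has_derivative
     (\<lambda>u. (u$i * m$j * m$k * m$l + m$i * u$j * m$k * m$l + m$i * m$j * u$k * m$l + m$i * m$j * m$k * u$l) \<bullet> c)) (at m)"
    by (auto intro!: derivative_eq_intros nth simp: algebra_simps)
  then show "((\<lambda>x. veronese4 x \<bullet> b) has_derivative
     (\<lambda>v. (tensor4 v m m m + tensor4 m v m m + tensor4 m m v m + tensor4 m m m v) \<bullet> b)) (at m)"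
    by (simp add: b p veronese4_def tensor4_def inner_axis)
qed

lemma veronese_tangent_eq:
  "veronese_tangent m =
     range (\<lambda>v. tensor4 v m m m + tensor4 m v m m + tensor4 m m v m + tensor4 m m m v)"
  unfolding veronese_tangent_def
  by (subst frechet_derivative_at[OF veronese4_has_derivative, symmetric]) (rule refl)

text \<open>
  Points of \<open>\<P>(\<complex>\<^sup>N)\<close> are the lines through the origin.
\<close>

definition proj_point :: "complex ^ 'n \<Rightarrow> (complex ^ 'n::finite) set" where
  "proj_point m = vec.span {m}"

text \<open>
  Representatives of distinct points are distinct, so no injectivity of \<open>f\<close> has to be required.
\<close>

definition proj_independent :: "(complex ^ 'n::finite) set set \<Rightarrow> bool" where
  "proj_independent B \<longleftrightarrow>
     (\<forall>f. (\<forall>P\<in>B. f P \<in> P \<and> f P \<noteq> 0) \<longrightarrow> vec.independent (f ` B))"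

definition linear_general_position :: "(complex ^ 'n::finite) set set \<Rightarrow> bool" where
  "linear_general_position A \<longleftrightarrow>
     (\<forall>B\<subseteq>A. card B \<le> min (card A) CARD('n) \<longrightarrow> proj_independent B)"

end

theory Submission
  imports Defs
begin

text \<open>
  Write \<open>a\<^sub>i\<close> for the given vectors. As \<open>2n + 1\<close> points in linear general position impose independent
  conditions on quadrics, contracting a decomposition \<open>T = \<Sum> b\<^sub>j\<^sup>4\<close> with separating quadrics gives
  \<open>a\<^sub>i\<^sup>2 \<in> \<langle>b\<^sub>j\<^sup>2\<rangle>\<close>; so there are at least \<open>2n + 1\<close> summands, and in case of equality
  \<open>b\<^sub>j\<^sup>2 = \<Sum> c\<^sub>j\<^sub>i a\<^sub>i\<^sup>2\<close> with an orthogonal matrix \<open>c\<close>. A row of \<open>c\<close> has a single nonzero entry or no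
  zero entry, and by orthogonality either all rows are of the first kind (the decompositions agree)
  or all are of the second kind.

  In the latter case, let \<open>K\<close> be the space of linear relations among the \<open>a\<^sub>i\<close> and \<open>U\<close> the space of
  value vectors \<open>(y \<cdot> a\<^sub>i)\<^sub>i\<close> of linear forms. Call \<open>e\<close> a multiplier if \<open>e K \<subseteq> U\<close>, a linear condition
  on \<open>e\<close>. The inverses of the rows of \<open>c\<close> are multipliers. Two of them, \<open>e\<close> and \<open>e'\<close>, span a pencil,
  which parametrises a rational normal curve through all the points: \<open>\<Sum> a\<^sub>i\<^sup>2 / (e\<^sub>i + s e'\<^sub>i)\<close> has rank
  one for general \<open>s\<close>. The square of this function of \<open>s\<close> decays quadratically at infinity, so its
  residues add up to zero. The residue at the pole belonging to \<open>a\<^sub>i\<close> is, up to a scalar,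
  \<open>a\<^sub>i\<^sup>2 \<Sum>\<^sub>j\<^sub>\<noteq>\<^sub>i a\<^sub>j\<^sup>2 / (e'\<^sub>i e\<^sub>j - e\<^sub>i e'\<^sub>j) = a\<^sub>i\<^sup>3 v\<^sub>i\<close> with \<open>v\<^sub>i \<noteq> 0\<close>. Hence \<open>\<Sum> a\<^sub>i\<^sup>3 v\<^sub>i = 0\<close>,
  contradicting Terracini's test.
\<close>

section \<open>Finite families of vectors\<close>

lemma span_image_iff_family:
  fixes f :: "'i \<Rightarrow> 'k::field ^ 'm::finite"
  assumes "finite I"
  shows "z \<in> vec.span (f ` I) \<longleftrightarrow> (\<exists>x. z = (\<Sum>i\<in>I. x i *s f i))"
proof
  assume "z \<in> vec.span (f ` I)"
  then show "\<exists>x. z = (\<Sum>i\<in>I. x i *s f i)"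
  proof (induction rule: vec.span_induct_alt)
    case base
    show ?case by (rule exI[of _ "\<lambda>_. 0"]) simp
  next
    case (step c u y)
    then obtain j x where j: "j \<in> I" "u = f j" and y: "y = (\<Sum>i\<in>I. x i *s f i)" by auto
    have "c *s u = (\<Sum>i\<in>I. (if i = j then c else 0) *s f i)"
      using j assms by (simp add: if_distrib[of "\<lambda>t. t *s _"] sum.delta cong: if_cong)
    then have "c *s u + y = (\<Sum>i\<in>I. ((if i = j then c else 0) + x i) *s f i)"
      by (simp add: y sum.distrib vec.scale_left_distrib)
    then show ?case by (rule exI[of _ "\<lambda>i. (if i = j then c else 0) + x i"])
  qed
next
  assume "\<exists>x. z = (\<Sum>i\<in>I. x i *s f i)"
  then show "z \<in> vec.span (f ` I)"
    by (auto intro!: vec.span_sum vec.span_scale intro: vec.span_base)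
qed

text \<open>A family with no more members than the dimension of its span can have neither
  repetitions nor relations. The dimension tests enter the proof in this form.\<close>

lemma family_independent_if_dim:
  fixes f :: "'i \<Rightarrow> 'k::field ^ 'm::finite"
  assumes I: "finite I" and dim: "card I \<le> vec.dim (vec.span (f ` I))"
    and sum: "(\<Sum>i\<in>I. x i *s f i) = 0" and i: "i \<in> I"
  shows "x i = 0"
proof -
  have le: "card I \<le> vec.dim (f ` I)" using dim by simp
  moreover have "vec.dim (f ` I) \<le> card (f ` I)"
    using I by (intro vec.dim_le_card vec.span_superset) auto
  ultimately have card: "card (f ` I) = card I" using card_image_le[OF I, of f] by linarith
  then have inj: "inj_on f I" by (simp add: I eq_card_imp_inj_on)
  have ind: "vec.independent (f ` I)"
    using vec.card_le_dim_spanning[OF vec.span_superset order_refl, of "f ` I"] I le card by simp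
  have "(\<Sum>v\<in>f ` I. x (the_inv_into I f v) *s v) = (\<Sum>i\<in>I. x i *s f i)"
    using inj by (simp add: sum.reindex the_inv_into_f_f)
  with sum have "(\<Sum>v\<in>f ` I. x (the_inv_into I f v) *s v) = 0" by simp
  then have "x (the_inv_into I f (f i)) = 0"
    using vec.independentD[OF ind, of "f ` I" "\<lambda>v. x (the_inv_into I f v)" "f i"] I i by auto
  then show ?thesis using inj i by (simp add: the_inv_into_f_f)
qed

lemma dim_span_family:
  fixes f :: "'i \<Rightarrow> 'k::field ^ 'm::finite"
  assumes I: "finite I"
    and ind: "\<And>x i. (\<Sum>i\<in>I. x i *s f i) = 0 \<Longrightarrow> i \<in> I \<Longrightarrow> x i = 0"
  shows "vec.dim (vec.span (f ` I)) = card I"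
proof -
  have inj: "inj_on f I"
  proof (rule inj_onI, rule ccontr)
    fix i j assume ij: "i \<in> I" "j \<in> I" "f i = f j" "i \<noteq> j"
    let ?x = "\<lambda>l. if l = i then 1 else if l = j then -1 else (0::'k)"
    have "(\<Sum>l\<in>I. ?x l *s f l) = (\<Sum>l\<in>{i, j}. ?x l *s f l)"
      using I ij by (intro sum.mono_neutral_right) auto
    also have "\<dots> = 0" using ij by simp
    finally show False using ind[of ?x i] ij by simp
  qed
  have "vec.independent (f ` I)"
  proof (rule vec.independent_if_scalars_zero)
    fix g v assume g: "(\<Sum>v\<in>f ` I. g v *s v) = 0" and v: "v \<in> f ` I"
    then have "(\<Sum>i\<in>I. g (f i) *s f i) = 0" using inj by (simp add: sum.reindex)
    then show "g v = 0" using ind[of "\<lambda>i. g (f i)"] v by auto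
  qed (use I in auto)
  then show ?thesis using inj by (simp add: vec.dim_eq_card_independent card_image)
qed

section \<open>Squares and fourth powers of vectors\<close>

text \<open>Complex bilinear, without the conjugation of a Hermitian product, because
  \<open>y\<close> stands for a linear form.\<close>

definition bdot :: "complex ^ 'n::finite \<Rightarrow> complex ^ 'n \<Rightarrow> complex" where
  "bdot y u = (\<Sum>t\<in>UNIV. y $ t * u $ t)"

lemma bdot_simps [simp]:
  "bdot 0 u = 0" "bdot y 0 = 0"
  "bdot (y + y') u = bdot y u + bdot y' u"
  "bdot y (u + u') = bdot y u + bdot y u'"
  "bdot (y - y') u = bdot y u - bdot y' u"
  "bdot y (u - u') = bdot y u - bdot y u'"
  "bdot (k *s y) u = k * bdot y u"
  "bdot y (k *s u) = k * bdot y u"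
  by (simp_all add: bdot_def sum.distrib sum_subtractf sum_distrib_left algebra_simps)

lemma bdot_axis [simp]:
  "bdot (axis p 1) u = u $ p" "bdot u (axis p 1) = u $ p"
  by (simp_all add: bdot_def axis_def if_distrib[of "\<lambda>t. _ * t"] if_distrib[of "\<lambda>t. t * _"] cong: if_cong)

lemma bdot_sum_right: "bdot y (\<Sum>i\<in>I. f i) = (\<Sum>i\<in>I. bdot y (f i))"
  by (induction I rule: infinite_finite_induct) auto

lemma bdot_eq_0_all: "(\<And>u. bdot y u = 0) \<Longrightarrow> y = 0"
  by (metis bdot_axis(2) vec_eq_iff zero_index)

text \<open>The symmetric matrix of rank at most one given by \<open>u\<close>, indexed by pairs so
  that the linear algebra of \<open>vec\<close> applies.\<close>

definition sym_square :: "complex ^ 'n \<Rightarrow> complex ^ ('n::finite \<times> 'n)" where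
  "sym_square u = (\<chi> p. u $ fst p * u $ snd p)"

lemma sym_square_nth: "sym_square u $ (p, q) = u $ p * u $ q"
  by (simp add: sym_square_def)

text \<open>Apply both sides, as matrices, to \<open>y\<close>: the matrix of \<open>u\<close> sends
  \<open>y\<close> to \<open>bdot y u *s u\<close>.\<close>

lemma sym_square_combination_contract:
  assumes "sym_square b = (\<Sum>i\<in>I. c i *s sym_square (a i))"
  shows "bdot y b *s b = (\<Sum>i\<in>I. (c i * bdot y (a i)) *s a i)"
proof (subst vec_eq_iff, intro allI)
  fix q
  have e: "b $ p * b $ q = (\<Sum>i\<in>I. c i * (a i $ p * a i $ q))" for p
    using arg_cong[OF assms, of "\<lambda>w. w $ (p, q)"] by (simp add: sym_square_nth)
  have "bdot y b * b $ q = (\<Sum>p\<in>UNIV. y $ p * (b $ p * b $ q))"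
    by (simp add: bdot_def sum_distrib_right mult.assoc)
  also have "\<dots> = (\<Sum>p\<in>UNIV. \<Sum>i\<in>I. y $ p * (c i * (a i $ p * a i $ q)))"
    by (simp add: e sum_distrib_left)
  also have "\<dots> = (\<Sum>i\<in>I. \<Sum>p\<in>UNIV. y $ p * (c i * (a i $ p * a i $ q)))"
    by (rule sum.swap)
  also have "\<dots> = (\<Sum>i\<in>I. c i * bdot y (a i) * a i $ q)"
    by (simp add: bdot_def sum_distrib_right sum_distrib_left mult_ac)
  finally show "(bdot y b *s b) $ q = (\<Sum>i\<in>I. (c i * bdot y (a i)) *s a i) $ q" by simp
qed

lemma sym_square_combination_contract2:
  assumes "sym_square b = (\<Sum>i\<in>I. c i *s sym_square (a i))"
  shows "bdot y b * bdot z b = (\<Sum>i\<in>I. c i * (bdot y (a i) * bdot z (a i)))"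
  using arg_cong[OF sym_square_combination_contract[OF assms, of y], of "bdot z"]
  by (simp add: bdot_sum_right mult.assoc)

lemma veronese4_nth: "veronese4 u $ (p, q, s, t) = u $ p * u $ q * u $ s * u $ t"
  by (simp add: veronese4_def tensor4_def)

text \<open>Contracting two of the four indices with \<open>y\<close> and \<open>z\<close> gives a
  matrix that depends only on the tensor, not on its decomposition.\<close>

lemma veronese4_sum_contract:
  assumes "(\<Sum>i\<in>I. veronese4 (a i)) = (\<Sum>j\<in>J. veronese4 (b j))"
  shows "(\<Sum>i\<in>I. (bdot y (a i) * bdot z (a i)) *s sym_square (a i)) =
         (\<Sum>j\<in>J. (bdot y (b j) * bdot z (b j)) *s sym_square (b j))"
proof -
  have gen: "(\<Sum>i\<in>I. (bdot y (f i) * bdot z (f i)) *s sym_square (f i)) $ (s, t) =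
      (\<Sum>p\<in>UNIV. \<Sum>q\<in>UNIV. y $ p * z $ q * (\<Sum>i\<in>I. veronese4 (f i)) $ (p, q, s, t))" 
    for I :: "'d set" and f :: "_ \<Rightarrow> complex ^ 'a" and s t
  proof -
    have expand: "bdot y u * bdot z u * k = (\<Sum>p\<in>UNIV. \<Sum>q\<in>UNIV. y $ p * z $ q * (u $ p * u $ q * k))"
      for u :: "complex ^ 'a" and k
      unfolding bdot_def sum_product by (simp add: sum_distrib_right sum_distrib_left mult_ac)
    have "(\<Sum>i\<in>I. (bdot y (f i) * bdot z (f i)) *s sym_square (f i)) $ (s, t) =
      (\<Sum>i\<in>I. bdot y (f i) * bdot z (f i) * (f i $ s * f i $ t))"
      by (simp add: sym_square_nth)
    also have "\<dots> = (\<Sum>i\<in>I. \<Sum>p\<in>UNIV. \<Sum>q\<in>UNIV. y $ p * z $ q * veronese4 (f i) $ (p, q, s, t))"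
      by (simp only: expand, simp only: veronese4_nth mult.assoc)
    also have "\<dots> = (\<Sum>p\<in>UNIV. \<Sum>i\<in>I. \<Sum>q\<in>UNIV. y $ p * z $ q * veronese4 (f i) $ (p, q, s, t))"
      by (rule sum.swap)
    also have "\<dots> = (\<Sum>p\<in>UNIV. \<Sum>q\<in>UNIV. \<Sum>i\<in>I. y $ p * z $ q * veronese4 (f i) $ (p, q, s, t))"
      by (intro sum.cong refl sum.swap)
    finally show ?thesis by (simp add: sum_distrib_left)
  qed
  show ?thesis
    by (subst vec_eq_iff) (auto simp only: gen assms split_paired_All)
qed

section \<open>Points in linear general position\<close>

text \<open>General position is expressed through indexed representatives instead of sets of lines;
  \<open>general_position_family\<close> provides the translation.\<close>

locale points_in_general_position =
  fixes a :: "'i \<Rightarrow> complex ^ 'n::finite" and R :: "'i set" and n :: nat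
  assumes dim: "CARD('n) = n + 1" and n_pos: "n \<ge> 1"
    and finite_R [simp]: "finite R" and card_R: "card R = 2 * n + 1"
    and general_position:
      "\<And>I x i. I \<subseteq> R \<Longrightarrow> card I \<le> n + 1 \<Longrightarrow> (\<Sum>i\<in>I. x i *s a i) = 0 \<Longrightarrow> i \<in> I \<Longrightarrow> x i = 0"
begin

lemma finite_subset_R: "I \<subseteq> R \<Longrightarrow> finite I"
  using finite_R by (rule finite_subset[rotated])

lemma spanning:
  assumes "I \<subseteq> R" "card I = n + 1"
  obtains x where "z = (\<Sum>i\<in>I. x i *s a i)"
proof -
  have fin: "finite I" using assms finite_subset_R by blast
  have "vec.dim (vec.span (a ` I)) = card I"
    using fin assms by (intro dim_span_family general_position[of I]) auto
  then have "vec.dim (vec.span (a ` I)) = vec.dim (UNIV :: (complex ^ 'n) set)"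
    using assms(2) dim by (metis vec_dim_card)
  then have "vec.span (a ` I) = UNIV"
    by (intro vec.subspace_dim_equal vec.subspace_span vec.subspace_UNIV subset_UNIV) simp
  then have "z \<in> vec.span (a ` I)" by simp
  then show ?thesis using that span_image_iff_family[OF fin] by blast
qed

lemma bdot_eq_0_if_vanishing:
  assumes "I \<subseteq> R" "card I = n + 1" "\<And>i. i \<in> I \<Longrightarrow> bdot y (a i) = 0"
  shows "y = 0"
proof (rule bdot_eq_0_all)
  fix u
  obtain x where "u = (\<Sum>i\<in>I. x i *s a i)" using spanning assms by blast
  then show "bdot y u = 0" using assms by (simp add: bdot_sum_right)
qed

text \<open>Evaluation at the points of \<open>I\<close> is an injective linear map between spaces
  of dimension \<open>n + 1\<close>, hence surjective. The bijection \<open>h\<close> makes it an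
  endomorphism of the coordinate space.\<close>

lemma interpolation:
  assumes I: "I \<subseteq> R" "card I = n + 1"
  obtains y where "\<And>i. i \<in> I \<Longrightarrow> bdot y (a i) = g i"
proof -
  have "finite I" using I finite_subset_R by blast
  then obtain h where h: "bij_betw h (UNIV :: 'n set) I"
    using finite_same_card_bij[of "UNIV :: 'n set" I] I dim by auto
  define L where "L = (\<lambda>y. \<chi> t. bdot y (a (h t)))"
  have lin: "Vector_Spaces.linear (*s) (*s) L"
    by (auto simp: L_def vec_eq_iff intro!: Vector_Spaces.linear.intro vec.module_hom_axioms
      simp: Vector_Spaces.linear_iff vec.vector_space_axioms)
  have inj: "inj L"
  proof (rule injI)
    fix y y' assume "L y = L y'"
    then have "bdot (y - y') (a (h t)) = 0" for t by (simp add: L_def vec_eq_iff)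
    then have "bdot (y - y') (a i) = 0" if "i \<in> I" for i
      using h that by (auto simp: bij_betw_def)
    then have "y - y' = 0" using bdot_eq_0_if_vanishing I by blast
    then show "y = y'" by simp
  qed
  have "surj L" using lin inj by (rule vec.linear_inj_imp_surj)
  then obtain y where "L y = (\<chi> t. g (h t))" by (metis surjD)
  then have "bdot y (a (h t)) = g (h t)" for t by (simp add: L_def vec_eq_iff)
  then have "\<And>i. i \<in> I \<Longrightarrow> bdot y (a i) = g i" using h by (auto simp: bij_betw_def)
  then show ?thesis by (rule that)
qed

lemma extend_to_basis:
  assumes "I \<subseteq> R" "card I \<le> n + 1"
  obtains J where "I \<subseteq> J" "J \<subseteq> R" "card J = n + 1"
  using exists_subset_between[of I "n + 1" R] assms card_R by auto

text \<open>The other \<open>2 * n\<close> points split into two sets of size \<open>n\<close>. The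
  quadric is the product of two linear forms, each vanishing on one of these sets and equal to 1 at
  \<open>a j\<close>.\<close>

lemma separating_quadric:
  assumes j: "j \<in> R"
  obtains y z where "\<And>i. i \<in> R \<Longrightarrow> bdot y (a i) * bdot z (a i) = (if i = j then 1 else 0)"
proof -
  have "card (R - {j}) = 2 * n" using j card_R by simp
  then obtain P where P: "P \<subseteq> R - {j}" "card P = n"
    using obtain_subset_with_card_n[of n "R - {j}"] by auto
  define Q where "Q = R - {j} - P"
  have fin: "finite P" "finite Q" using P finite_subset_R unfolding Q_def by blast+
  have cQ: "card Q = n" unfolding Q_def using P \<open>card (R - {j}) = 2 * n\<close> fin
    by (simp add: card_Diff_subset)
  have "insert j P \<subseteq> R" "card (insert j P) = n + 1" "insert j Q \<subseteq> R" "card (insert j Q) = n + 1"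
    using j P cQ fin by (auto simp: Q_def card_insert_if)
  note P' = this(1,2) and Q' = this(3,4)
  obtain y where y: "\<And>i. i \<in> insert j P \<Longrightarrow> bdot y (a i) = (if i = j then 1 else 0)"
    using interpolation[OF P', of "\<lambda>i. if i = j then 1 else 0"] by blast
  obtain z where z: "\<And>i. i \<in> insert j Q \<Longrightarrow> bdot z (a i) = (if i = j then 1 else 0)"
    using interpolation[OF Q', of "\<lambda>i. if i = j then 1 else 0"] by blast
  show ?thesis
  proof (rule that)
    fix i assume i: "i \<in> R"
    then consider "i = j" | "i \<in> P" "i \<noteq> j" | "i \<in> Q" "i \<noteq> j" using P Q_def by auto
    then show "bdot y (a i) * bdot z (a i) = (if i = j then 1 else 0)"
      by cases (use y[of i] z[of i] in auto)
  qed
qed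

lemma sym_squares_independent:
  assumes "(\<Sum>i\<in>R. x i *s sym_square (a i)) = 0" "j \<in> R"
  shows "x j = 0"
proof -
  obtain y z where yz: "\<And>i. i \<in> R \<Longrightarrow> bdot y (a i) * bdot z (a i) = (if i = j then 1 else 0)"
    using separating_quadric assms by blast
  \<comment> \<open>The contraction lemma expects a square on the left, so zero is written as
    one.\<close>
  have "sym_square 0 = (\<Sum>i\<in>R. x i *s sym_square (a i))"
    using assms by (simp add: sym_square_def vec_eq_iff)
  from sym_square_combination_contract2[OF this, of y z]
  have "0 = (\<Sum>i\<in>R. x i * (if i = j then 1 else 0))" by (simp add: yz)
  then show ?thesis using assms by (simp add: if_distrib[of "\<lambda>t. _ * t"] cong: if_cong)
qed

text \<open>Suppose that the support \<open>S\<close> of \<open>c\<close> is proper and contains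
  \<open>i\<close> and \<open>j\<close>, and let \<open>I\<close> be an independent part of it
  containing both. Contracting with a form that vanishes at \<open>b\<close> and on
  \<open>S - I\<close> leaves a relation on \<open>I\<close>, so the form vanishes on
  \<open>I\<close>. But forms vanishing on \<open>S - I\<close> still take arbitrary values at
  \<open>i\<close> and \<open>j\<close>, and vanishing at \<open>b\<close> is only one further
  condition.\<close>

lemma sym_square_in_span_cases:
  assumes b: "b \<noteq> 0" "sym_square b = (\<Sum>i\<in>R. c i *s sym_square (a i))"
  obtains (full) "\<And>i. i \<in> R \<Longrightarrow> c i \<noteq> 0"
    | (single) i where "i \<in> R" "c i \<noteq> 0" "\<And>l. l \<in> R \<Longrightarrow> l \<noteq> i \<Longrightarrow> c l = 0"
proof -
  define S where "S = {i \<in> R. c i \<noteq> 0}"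
  have S: "S \<subseteq> R" "finite S" unfolding S_def by auto
  have contract: "bdot y b *s b = (\<Sum>i\<in>R. (c i * bdot y (a i)) *s a i)" for y
    using sym_square_combination_contract[OF b(2)] .
  have "S \<noteq> {}"
  proof
    assume "S = {}"
    then have "bdot y b *s b = 0" for y unfolding contract by (intro sum.neutral) (auto simp: S_def)
    from this[of "axis p 1" for p] have "b $ p = 0" for p using b(1) by simp
    then show False using b(1) by (simp add: vec_eq_iff)
  qed
  then obtain i where i: "i \<in> S" by auto
  have False if "S \<noteq> R" and j: "j \<in> S" "j \<noteq> i" for j
  proof -
    have "S \<subset> R" using S that by auto
    then have cS: "card S \<le> 2 * n" using psubset_card_mono[of R S] card_R by simp
    have "2 \<le> card S" using card_mono[of S "{i, j}"] S i j by auto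
    \<comment> \<open>At most \<open>n + 1\<close> elements keep \<open>I\<close> independent.
      Taking as many as possible leaves at most \<open>n - 1\<close> in \<open>S - I\<close>, so
      \<open>i\<close> and \<open>j\<close> can be added within a basis.\<close>
    then obtain I where I: "{i, j} \<subseteq> I" "I \<subseteq> S" "card I = min (n + 1) (card S)"
      using exists_subset_between[of "{i, j}" "min (n + 1) (card S)" S] S i j n_pos by auto
    have fI: "finite I" using I S finite_subset by blast
    have "card (S - I \<union> {i, j}) \<le> card (S - I) + 2"
      by (rule order_trans[OF card_Un_le]) (use j in simp)
    also have "\<dots> \<le> n + 1" using I fI cS n_pos by (simp add: card_Diff_subset)
    finally obtain J where J: "S - I \<union> {i, j} \<subseteq> J" "J \<subseteq> R" "card J = n + 1"
      using extend_to_basis[of "S - I \<union> {i, j}"] S i j by blast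
    have key: "bdot y (a l) = 0"
      if yb: "bdot y b = 0" and yv: "\<And>l. l \<in> S - I \<Longrightarrow> bdot y (a l) = 0" and l: "l \<in> I" for y l
    proof -
      have "(\<Sum>l\<in>I. (c l * bdot y (a l)) *s a l) = (\<Sum>i\<in>R. (c i * bdot y (a i)) *s a i)"
        using I S yv by (intro sum.mono_neutral_left) (auto simp: S_def)
      also have "\<dots> = 0" using contract[of y] yb by simp
      finally have "c l * bdot y (a l) = 0"
        using general_position[of I "\<lambda>l. c l * bdot y (a l)" l] I S l by auto
      then show ?thesis using l I S_def by auto
    qed
    obtain y where y: "\<And>l. l \<in> J \<Longrightarrow> bdot y (a l) = (if l = i then 1 else 0)"
      using interpolation[of J "\<lambda>l. if l = i then 1 else 0"] J by auto
    obtain z where z: "\<And>l. l \<in> J \<Longrightarrow> bdot z (a l) = (if l = j then 1 else 0)"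
      using interpolation[of J "\<lambda>l. if l = j then 1 else 0"] J by auto
    \<comment> \<open>The combination of \<open>y\<close> and \<open>z\<close> whose hyperplane contains \<open>b\<close>.\<close>
    let ?w = "bdot z b *s y - bdot y b *s z"
    have w: "bdot ?w (a l) = 0" if "l \<in> S - I" for l
      using that J I y[of l] z[of l] by auto
    have "bdot ?w (a j) = 0" using key[of ?w j] w I by simp
    then have "bdot y b = 0" using y[of j] z[of j] J j by auto
    moreover have "bdot y (a l) = 0" if "l \<in> S - I" for l
      using that J I y[of l] by auto
    ultimately have "bdot y (a i) = 0" using key[of y i] I by blast
    then show False using y[of i] J by auto
  qed
  then show ?thesis using that i S_def by blast
qed

section \<open>Linear relations among the points, and multipliers\<close>

definition relation :: "('i \<Rightarrow> complex) \<Rightarrow> bool" where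
  "relation k \<longleftrightarrow> (\<Sum>i\<in>R. k i *s a i) = 0"

text \<open>The remaining \<open>n + 1\<close> points form a basis, in which the prescribed part can
  be compensated. Together with \<open>relation_eq_0\<close>, any \<open>n\<close> points serve as
  coordinates on the space of relations.\<close>

lemma relation_interpolation:
  assumes P: "P \<subseteq> R" "card P = n"
  obtains k where "relation k" "\<And>i. i \<in> P \<Longrightarrow> k i = f i"
proof -
  have fP: "finite P" using P finite_subset_R by blast
  have "card (R - P) = n + 1" using P fP card_R by (simp add: card_Diff_subset)
  then obtain x where x: "- (\<Sum>i\<in>P. f i *s a i) = (\<Sum>i\<in>R - P. x i *s a i)"
    using spanning[of "R - P"] by auto
  let ?k = "\<lambda>i. if i \<in> P then f i else x i"
  have "(\<Sum>i\<in>R. ?k i *s a i) = (\<Sum>i\<in>R - P. ?k i *s a i) + (\<Sum>i\<in>P. ?k i *s a i)"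
    using P by (intro sum.subset_diff) auto
  also have "\<dots> = 0" by (simp add: x[symmetric])
  finally have "relation ?k" by (simp add: relation_def)
  then show ?thesis by (rule that) simp
qed

lemma relation_eq_0:
  assumes k: "relation k" and P: "P \<subseteq> R" "card P = n" "\<And>i. i \<in> P \<Longrightarrow> k i = 0" and j: "j \<in> R"
  shows "k j = 0"
proof (cases "j \<in> P")
  case False
  have fP: "finite P" using P finite_subset_R by blast
  have "card (R - P) = n + 1" using P fP card_R by (simp add: card_Diff_subset)
  moreover have "(\<Sum>i\<in>R - P. k i *s a i) = (\<Sum>i\<in>R. k i *s a i)"
    using P by (intro sum.mono_neutral_left) auto
  ultimately show ?thesis
    using general_position[of "R - P" k j] k False j by (auto simp: relation_def)
qed (use P in auto)

definition multiplier :: "('i \<Rightarrow> complex) \<Rightarrow> bool" where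
  "multiplier e \<longleftrightarrow> (\<forall>k. relation k \<longrightarrow> (\<exists>y. \<forall>i\<in>R. bdot y (a i) = e i * k i))"

lemma multiplierE:
  assumes "multiplier e" "relation k"
  obtains y where "\<And>i. i \<in> R \<Longrightarrow> bdot y (a i) = e i * k i"
  using assms unfolding multiplier_def by blast

lemma multiplier_combination:
  assumes "multiplier e" "multiplier e'"
  shows "multiplier (\<lambda>i. s * e i - t * e' i)"
  unfolding multiplier_def
proof (intro allI impI)
  fix k assume k: "relation k"
  obtain y where y: "\<And>i. i \<in> R \<Longrightarrow> bdot y (a i) = e i * k i"
    using multiplierE[OF assms(1) k] by blast
  obtain y' where y': "\<And>i. i \<in> R \<Longrightarrow> bdot y' (a i) = e' i * k i"
    using multiplierE[OF assms(2) k] by blast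
  have "\<forall>i\<in>R. bdot (s *s y - t *s y') (a i) = (s * e i - t * e' i) * k i"
    by (simp add: y y' algebra_simps)
  then show "\<exists>y. \<forall>i\<in>R. bdot y (a i) = (s * e i - t * e' i) * k i" by blast
qed

text \<open>If a form vanishes at \<open>b\<close>, contraction shows that its values multiplied by
  \<open>c\<close> are a relation. The forms vanishing at \<open>b\<close> and the relations both
  have dimension \<open>n\<close>, so every relation arises this way, and division by
  \<open>c\<close> recovers the form.\<close>

lemma multiplier_reciprocal:
  assumes b: "sym_square b = (\<Sum>i\<in>R. c i *s sym_square (a i))" and c: "\<And>i. i \<in> R \<Longrightarrow> c i \<noteq> 0"
  shows "multiplier (\<lambda>i. 1 / c i)"
  unfolding multiplier_def
proof (intro allI impI)
  fix k assume k: "relation k"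
  have rel: "relation (\<lambda>i. c i * bdot y (a i))" if "bdot y b = 0" for y
    using sym_square_combination_contract[OF b, of y] that by (simp add: relation_def)
  obtain P where P: "P \<subseteq> R" "card P = n"
    using obtain_subset_with_card_n[of n R] card_R by auto
  have fP: "finite P" using P finite_subset_R by blast
  have "card (R - P) \<noteq> 0" using P fP card_R by (simp add: card_Diff_subset)
  then obtain p where p: "p \<in> R - P" by (metis card.empty ex_in_conv)
  have ins: "insert p P \<subseteq> R" "card (insert p P) = n + 1" using p P fP by auto
  obtain y where y: "\<And>i. i \<in> insert p P \<Longrightarrow> bdot y (a i) = (if i = p then 0 else k i / c i)"
    using interpolation[OF ins, of "\<lambda>i. if i = p then 0 else k i / c i"] by auto
  obtain z where z: "\<And>i. i \<in> insert p P \<Longrightarrow> bdot z (a i) = (if i = p then 1 else 0)"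
    using interpolation[OF ins, of "\<lambda>i. if i = p then 1 else 0"] by auto
  have zP: "bdot z (a i) = 0" if "i \<in> P" for i using z[of i] p that by auto
  have yP: "bdot y (a i) = k i / c i" if "i \<in> P" for i using y[of i] p that by auto
  have "bdot z b \<noteq> 0"
  proof
    assume "bdot z b = 0"
    from relation_eq_0[OF rel[OF this] P, of p] zP p
    have "c p * bdot z (a p) = 0" by auto
    then show False using c[of p] z[of p] p by auto
  qed
  \<comment> \<open>\<open>z\<close> vanishes on \<open>P\<close> but not at \<open>b\<close>, so
    this correction makes the form vanish at \<open>b\<close> without changing its values on
    \<open>P\<close>.\<close>
  define w where "w = y - (bdot y b / bdot z b) *s z"
  have "bdot w b = 0" using \<open>bdot z b \<noteq> 0\<close> by (simp add: w_def)
  then have rw: "relation (\<lambda>i. c i * bdot w (a i) - k i)"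
    using rel[of w] k by (simp add: relation_def vec.scale_left_diff_distrib sum_subtractf)
  have "c i * bdot w (a i) - k i = 0" if "i \<in> R" for i
    by (rule relation_eq_0[OF rw P _ that]) (use c P in \<open>auto simp: w_def zP yP\<close>)
  then have "\<forall>i\<in>R. bdot w (a i) = 1 / c i * k i" using c by (auto simp: field_simps)
  then show "\<exists>y. \<forall>i\<in>R. bdot y (a i) = 1 / c i * k i" by blast
qed

text \<open>
  Choose \<open>k\<close> with \<open>k l \<noteq> 0\<close> and \<open>n - 1\<close> zeros away from \<open>i\<close> and \<open>j\<close>: then \<open>e k\<close> has \<open>n + 1\<close> zeros.
\<close>

lemma multiplier_two_zeros:
  assumes e: "multiplier e" and ij: "i \<in> R" "j \<in> R" "i \<noteq> j" "e i = 0" "e j = 0" and l: "l \<in> R"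
  shows "e l = 0"
proof (rule ccontr)
  assume el: "e l \<noteq> 0"
  then have "l \<noteq> i" "l \<noteq> j" using ij by auto
  have "card (R - {i, j}) = 2 * n - 1" using ij card_R by (simp add: card_Diff_subset)
  then have "card {l} \<le> n" "n \<le> card (R - {i, j})" "{l} \<subseteq> R - {i, j}" "finite (R - {i, j})"
    using n_pos l \<open>l \<noteq> i\<close> \<open>l \<noteq> j\<close> by auto
  from exists_subset_between[OF this] obtain P where P: "{l} \<subseteq> P" "P \<subseteq> R - {i, j}" "card P = n"
    by blast
  have PR: "P \<subseteq> R" and fP: "finite P" using P finite_subset_R by blast+
  obtain k where k: "relation k" "\<And>m. m \<in> P \<Longrightarrow> k m = (if m = l then 1 else 0)"
    using relation_interpolation[OF PR P(3), of "\<lambda>m. if m = l then 1 else 0"] by auto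
  obtain y where y: "\<And>m. m \<in> R \<Longrightarrow> bdot y (a m) = e m * k m" using multiplierE[OF e k(1)] by auto
  have "y = 0"
  proof (rule bdot_eq_0_if_vanishing)
    show "insert i (insert j (P - {l})) \<subseteq> R" using ij PR by auto
    have "i \<notin> insert j (P - {l})" "j \<notin> P - {l}" "card (P - {l}) = n - 1"
      using P fP ij by auto
    then show "card (insert i (insert j (P - {l}))) = n + 1"
      using fP n_pos by simp
    show "bdot y (a m) = 0" if "m \<in> insert i (insert j (P - {l}))" for m
      using that y[of m] k(2)[of m] ij PR by auto
  qed
  then show False using y[of l] k(2)[of l] el l P by auto
qed

end

section \<open>Tangent vectors\<close>

text \<open>In polynomial terms, \<open>4 u^3 v\<close>.\<close>

definition veronese4_differential ::
    "complex ^ 'n \<Rightarrow> complex ^ 'n \<Rightarrow> ('n::finite) tensor4" where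
  "veronese4_differential u v =
     tensor4 v u u u + tensor4 u v u u + tensor4 u u v u + tensor4 u u u v"

text \<open>Grouped by the Leibniz rule for \<open>u^2\<close> times \<open>u^2\<close>, so that the
  mixed factors match the output of \<open>base_locus_tangent\<close>.\<close>

lemma veronese4_differential_nth:
  "veronese4_differential u v $ (p, q, s, t) =
     (u $ p * v $ q + v $ p * u $ q) * (u $ s * u $ t) +
     (u $ p * u $ q) * (u $ s * v $ t + v $ s * u $ t)"
  by (simp add: veronese4_differential_def tensor4_def algebra_simps)

context points_in_general_position
begin

text \<open>Read the sum as a symmetric bilinear form \<open>N\<close> on linear forms. If
  \<open>y\<close> vanishes at \<open>a i\<close>, its values divided by \<open>e\<close> agree away
  from \<open>i\<close> with a relation \<open>k\<close>. If \<open>z\<close> vanishes there too,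
  the unknown coefficient \<open>k i\<close> does not matter, and \<open>N y z\<close> is
  \<open>z\<close> applied to that relation, hence 0.\<close>

lemma base_locus_tangent:
  assumes e: "multiplier e" and i: "i \<in> R" "e i = 0" and nz: "\<And>j. j \<in> R - {i} \<Longrightarrow> e j \<noteq> 0"
  obtains v where
    "\<And>p q. (\<Sum>j\<in>R - {i}. 1 / e j * (a j $ p * a j $ q)) = a i $ p * v $ q + v $ p * a i $ q"
proof -
  define N where "N y z = (\<Sum>j\<in>R - {i}. 1 / e j * (bdot y (a j) * bdot z (a j)))" for y z
  have N_perp: "N y z = 0" if y: "bdot y (a i) = 0" and z: "bdot z (a i) = 0" for y z
  proof -
    have "card (R - {i}) = 2 * n" using i card_R by simp
    then obtain P where P: "P \<subseteq> R - {i}" "card P = n"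
      using obtain_subset_with_card_n[of n "R - {i}"] by auto
    have PR: "P \<subseteq> R" and fP: "finite P" using P finite_subset_R by blast+
    obtain k where k: "relation k" "\<And>j. j \<in> P \<Longrightarrow> k j = bdot y (a j) / e j"
      using relation_interpolation[OF PR P(2), of "\<lambda>j. bdot y (a j) / e j"] by blast
    obtain w where w: "\<And>j. j \<in> R \<Longrightarrow> bdot w (a j) = e j * k j" using multiplierE[OF e k(1)] by blast
    \<comment> \<open>Both forms vanish at \<open>a i\<close>, as \<open>e i = 0\<close>, and they
      agree on \<open>P\<close>: this makes \<open>n + 1\<close> points.\<close>
    have "w - y = 0"
    proof (rule bdot_eq_0_if_vanishing)
      show "insert i P \<subseteq> R" "card (insert i P) = n + 1" using i P fP by (auto simp: card_insert_if)
      show "bdot (w - y) (a j) = 0" if "j \<in> insert i P" for j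
      proof (cases "j = i")
        case False
        then have "j \<in> P" "j \<in> R - {i}" using that P by auto
        then show ?thesis using w[of j] k(2)[of j] nz[of j] by simp
      qed (use w[of i] i y in simp)
    qed
    then have "1 / e j * bdot y (a j) = k j" if "j \<in> R - {i}" for j
      using w[of j] nz[of j] that by auto
    then have "N y z = (\<Sum>j\<in>R - {i}. k j * bdot z (a j))"
      unfolding N_def by (intro sum.cong) (auto simp: mult.assoc[symmetric])
    also have "\<dots> = (\<Sum>j\<in>R. k j * bdot z (a j))"
      using z by (intro sum.mono_neutral_left) auto
    also have "\<dots> = bdot z (\<Sum>j\<in>R. k j *s a j)" by (simp add: bdot_sum_right)
    also have "\<dots> = 0" using k(1) by (simp add: relation_def)
    finally show ?thesis .
  qed
  have "{i} \<subseteq> R" "card {i} \<le> n + 1" using i by auto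
  then obtain J where J: "{i} \<subseteq> J" "J \<subseteq> R" "card J = n + 1" by (rule extend_to_basis)
  obtain u where "\<And>j. j \<in> J \<Longrightarrow> bdot u (a j) = 1"
    by (rule interpolation[OF J(2,3), of "\<lambda>_. 1"]) blast
  then have u: "bdot u (a i) = 1" using J(1) by simp
  have bilin: "N (y - s *s u) (z - t *s u) = N y z - t * N u y - s * N u z + s * t * N u u" for y z s t
    unfolding N_def sum_distrib_left sum_subtractf[symmetric] sum.distrib[symmetric]
    by (intro sum.cong refl) (simp add: algebra_simps)
  \<comment> \<open>Subtracting multiples of \<open>u\<close> moves both arguments into the
    hyperplane of forms vanishing at \<open>a i\<close>, where \<open>N_perp\<close>
    applies.\<close>
  have eq: "N y z = bdot z (a i) * N u y + bdot y (a i) * N u z - bdot y (a i) * bdot z (a i) * N u u" for y z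
    using N_perp[of "y - bdot y (a i) *s u" "z - bdot z (a i) *s u"] u
    by (simp add: bilin algebra_simps)
  \<comment> \<open>\<open>N\<close> vanishes on the hyperplane orthogonal to \<open>a i\<close>, so it is the symmetric product of \<open>a i\<close> with some \<open>v\<close>.\<close>
  define v where "v = (\<chi> p. N u (axis p 1) - 1 / 2 * N u u * a i $ p)"
  show ?thesis
  proof (rule that)
    fix p q
    have "(\<Sum>j\<in>R - {i}. 1 / e j * (a j $ p * a j $ q)) = N (axis p 1) (axis q 1)"
      by (simp add: N_def)
    also have "\<dots> = a i $ p * v $ q + v $ p * a i $ q"
      by (subst eq) (simp add: v_def algebra_simps)
    finally show "(\<Sum>j\<in>R - {i}. 1 / e j * (a j $ p * a j $ q)) = a i $ p * v $ q + v $ p * a i $ q" .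
  qed
qed

text \<open>\<open>D i\<close> is the member of the pencil of the two reciprocal rows that vanishes
  at \<open>i\<close>; \<open>base_locus_tangent\<close> turns its weighted sum of squares into a
  symmetric product of \<open>a i\<close> and \<open>v i\<close>. The residue theorem of the
  overview becomes an explicit cancellation in a double sum.\<close>

lemma tangent_spaces_dependent:
  assumes b: "sym_square b = (\<Sum>i\<in>R. c i *s sym_square (a i))" "\<And>i. i \<in> R \<Longrightarrow> c i \<noteq> 0"
    and b': "sym_square b' = (\<Sum>i\<in>R. c' i *s sym_square (a i))" "\<And>i. i \<in> R \<Longrightarrow> c' i \<noteq> 0"
    and distinct: "\<And>t. \<exists>i\<in>R. c' i \<noteq> t * c i"
  obtains v where "(\<Sum>i\<in>R. veronese4_differential (a i) (v i)) = 0" "\<And>i. i \<in> R \<Longrightarrow> v i \<noteq> 0"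
proof -
  define D where "D i j = 1 / c' i * (1 / c j) - 1 / c i * (1 / c' j)" for i j
  have mult: "multiplier (D i)" for i
    unfolding D_def
    by (intro multiplier_combination multiplier_reciprocal[OF b] multiplier_reciprocal[OF b'])
  have D_refl: "D i i = 0" for i by (simp add: D_def)
  have D_anti: "D j i = - D i j" for i j by (simp add: D_def mult.commute)
  have D_nz: "D i j \<noteq> 0" if ij: "i \<in> R" "j \<in> R - {i}" for i j
  \<comment> \<open>A second zero would force \<open>D i\<close> to vanish on all of
    \<open>R\<close>, making \<open>c'\<close> proportional to \<open>c\<close>.\<close>
  proof
    assume "D i j = 0"
    then have "D i l = 0" if "l \<in> R" for l
      using multiplier_two_zeros[OF mult, of i j i l] ij D_refl that by auto
    then have "c' l = c' i / c i * c l" if "l \<in> R" for l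
      using that ij b(2) b'(2) by (force simp: D_def field_simps)
    then show False using distinct by blast
  qed
  have "\<forall>i\<in>R. \<exists>v. \<forall>p q.
      (\<Sum>j\<in>R - {i}. 1 / D i j * (a j $ p * a j $ q)) = a i $ p * v $ q + v $ p * a i $ q"
  proof
    fix i assume i: "i \<in> R"
    show "\<exists>v. \<forall>p q.
      (\<Sum>j\<in>R - {i}. 1 / D i j * (a j $ p * a j $ q)) = a i $ p * v $ q + v $ p * a i $ q"
      by (rule base_locus_tangent[OF mult i D_refl D_nz[OF i]]) blast+
  qed
  from bchoice[OF this] obtain v where v: "\<And>i p q. i \<in> R \<Longrightarrow>
      (\<Sum>j\<in>R - {i}. 1 / D i j * (a j $ p * a j $ q)) = a i $ p * v i $ q + v i $ p * a i $ q"
    by blast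
  show ?thesis
  proof (rule that)
    show "(\<Sum>i\<in>R. veronese4_differential (a i) (v i)) = 0"
    proof (subst vec_eq_iff, clarify)
      fix p q s t
      \<comment> \<open>The double sum vanishes because \<open>D\<close> is antisymmetric; the diagonal drops out as \<open>1 / D i i = 1 / 0 = 0\<close>.\<close>
      let ?X = "\<lambda>i j. 1 / D i j * (a j $ p * a j $ q) * (a i $ s * a i $ t)"
      let ?Y = "\<lambda>i j. 1 / D i j * (a i $ p * a i $ q) * (a j $ s * a j $ t)"
      have drop: "(\<Sum>j\<in>R - {i}. 1 / D i j * g j) = (\<Sum>j\<in>R. 1 / D i j * g j)" for i g
        by (intro sum.mono_neutral_left) (auto simp: D_refl)
      have "veronese4_differential (a i) (v i) $ (p, q, s, t) =
          (\<Sum>j\<in>R. ?X i j) + (\<Sum>j\<in>R. ?Y i j)" if "i \<in> R" for i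
        unfolding veronese4_differential_nth v[OF that, symmetric] drop sum_distrib_left sum_distrib_right
        by (simp add: mult_ac)
      then have "(\<Sum>i\<in>R. veronese4_differential (a i) (v i)) $ (p, q, s, t) =
          (\<Sum>i\<in>R. (\<Sum>j\<in>R. ?X i j) + (\<Sum>j\<in>R. ?Y i j))"
        by simp
      also have "\<dots> = (\<Sum>i\<in>R. \<Sum>j\<in>R. ?X i j) + (\<Sum>j\<in>R. \<Sum>i\<in>R. ?Y j i)"
        by (simp add: sum.distrib)
      also have "(\<Sum>j\<in>R. \<Sum>i\<in>R. ?Y j i) = (\<Sum>i\<in>R. \<Sum>j\<in>R. ?Y j i)" by (rule sum.swap)
      also have "\<dots> = (\<Sum>i\<in>R. \<Sum>j\<in>R. - ?X i j)"
        by (intro sum.cong refl) (subst D_anti, simp)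
      finally show "(\<Sum>i\<in>R. veronese4_differential (a i) (v i)) $ (p, q, s, t) = 0 $ (p, q, s, t)"
        by (simp add: sum_negf)
    qed
    \<comment> \<open>Otherwise the squares of the points other than \<open>a i\<close> would
      satisfy a relation with nonzero coefficients.\<close>
    show "v i \<noteq> 0" if i: "i \<in> R" for i
    proof
      assume "v i = 0"
      then have "(\<Sum>j\<in>R - {i}. 1 / D i j * (a j $ p * a j $ q)) = 0" for p q
        using v[OF i, of p q] by simp
      moreover have "(\<Sum>j\<in>R - {i}. 1 / D i j * (a j $ p * a j $ q)) = (\<Sum>j\<in>R. 1 / D i j * (a j $ p * a j $ q))" for p q
        by (intro sum.mono_neutral_left) (auto simp: D_refl)
      ultimately have "(\<Sum>j\<in>R. (1 / D i j) *s sym_square (a j)) = 0"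
        by (simp add: vec_eq_iff sym_square_nth)
      then have "1 / D i j = 0" if "j \<in> R" for j
        using sym_squares_independent[of "\<lambda>j. 1 / D i j"] that by blast
      moreover have "card (R - {i}) \<noteq> 0" using card_R n_pos i by simp
      then obtain j where "j \<in> R - {i}" by (metis card.empty ex_in_conv)
      ultimately show False using D_nz[OF i, of j] by auto
    qed
  qed
qed

text \<open>Admitting shorter decompositions yields the rank together with uniqueness. Only the set
  of summands is compared here; multiplicities are settled in the final theorem.\<close>

lemma decomposition_unique:
  fixes b :: "'j \<Rightarrow> complex ^ 'n"
  assumes J: "finite J" "card J \<le> card R"
    and sum: "(\<Sum>i\<in>R. veronese4 (a i)) = (\<Sum>j\<in>J. veronese4 (b j))"
    and terracini: "\<And>v i. (\<Sum>i\<in>R. veronese4_differential (a i) (v i)) = 0 \<Longrightarrow> i \<in> R \<Longrightarrow> v i = 0"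
  shows "card J = card R" and "j \<in> J \<Longrightarrow> veronese4 (b j) \<in> (\<lambda>i. veronese4 (a i)) ` R"
proof -
  let ?A = "\<lambda>i. sym_square (a i)" and ?B = "\<lambda>j. sym_square (b j)"
  have "\<forall>l\<in>R. \<exists>w. \<forall>i\<in>R. bdot (fst w) (a i) * bdot (snd w) (a i) = (if i = l then 1 else 0)"
  proof
    fix l assume "l \<in> R"
    then obtain y z where
      "\<And>i. i \<in> R \<Longrightarrow> bdot y (a i) * bdot z (a i) = (if i = l then 1 else 0)"
      by (rule separating_quadric) blast
    then show "\<exists>w. \<forall>i\<in>R. bdot (fst w) (a i) * bdot (snd w) (a i) = (if i = l then 1 else 0)"
      by (intro exI[of _ "(y, z)"]) simp
  qed
  from bchoice[OF this] obtain w where "\<forall>l\<in>R. \<forall>i\<in>R.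
      bdot (fst (w l)) (a i) * bdot (snd (w l)) (a i) = (if i = l then 1 else 0)" by blast
  moreover define y z where "y l = fst (w l)" and "z l = snd (w l)" for l
  ultimately have yz: "bdot (y l) (a i) * bdot (z l) (a i) = (if i = l then 1 else 0)"
    if "l \<in> R" "i \<in> R" for l i
    using that by simp
  \<comment> \<open>The value at \<open>b j\<close> of the quadric separating \<open>a i\<close>
    from the other points. Contracting both decompositions with this quadric isolates
    \<open>?A i\<close> on one side.\<close>
  define Q where "Q i j = bdot (y i) (b j) * bdot (z i) (b j)" for i j
  have AQ: "?A l = (\<Sum>j\<in>J. Q l j *s ?B j)" if l: "l \<in> R" for l
  proof -
    have "(\<Sum>j\<in>J. Q l j *s ?B j) = (\<Sum>i\<in>R. (bdot (y l) (a i) * bdot (z l) (a i)) *s ?A i)"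
      unfolding Q_def using veronese4_sum_contract[OF sum] by simp
    also have "\<dots> = (\<Sum>i\<in>R. (if i = l then ?A i else 0))"
      using yz l by (intro sum.cong) auto
    finally show ?thesis using l by simp
  qed
  have sub: "vec.span (?A ` R) \<subseteq> vec.span (?B ` J)"
    using AQ by (intro vec.span_minimal vec.subspace_span) (auto simp: span_image_iff_family[OF J(1)])
  have dimA: "vec.dim (vec.span (?A ` R)) = card R"
    by (intro dim_span_family sym_squares_independent) auto
  have "vec.dim (vec.span (?A ` R)) \<le> vec.dim (vec.span (?B ` J))"
    using sub by (rule vec.dim_subset)
  moreover have "vec.dim (vec.span (?B ` J)) \<le> card (?B ` J)"
    using J by (intro vec.dim_le_card) auto
  moreover have "card (?B ` J) \<le> card J" using J by (intro card_image_le)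
  ultimately have cards: "card J = card R" and dimB: "vec.dim (vec.span (?B ` J)) = card J"
    using dimA J by linarith+
  show "card J = card R" by fact
  have indB: "x j = 0" if "(\<Sum>j\<in>J. x j *s ?B j) = 0" "j \<in> J" for x j
    using family_independent_if_dim[of J ?B x j] J dimB that by simp
  have eq: "vec.span (?A ` R) = vec.span (?B ` J)"
    using sub dimA dimB cards by (intro vec.subspace_dim_equal vec.subspace_span) auto
  have "\<forall>j\<in>J. \<exists>x. ?B j = (\<Sum>i\<in>R. x i *s ?A i)"
  proof
    fix j assume "j \<in> J"
    then have "?B j \<in> vec.span (?A ` R)" unfolding eq by (intro vec.span_base imageI)
    then show "\<exists>x. ?B j = (\<Sum>i\<in>R. x i *s ?A i)" by (simp only: span_image_iff_family[OF finite_R])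
  qed
  from bchoice[OF this] obtain c where c: "\<And>j. j \<in> J \<Longrightarrow> ?B j = (\<Sum>i\<in>R. c j i *s ?A i)" by blast
  \<comment> \<open>Evaluating the separating quadric at \<open>b j\<close> reads off one
    coefficient. The expansions in the two directions thus have transposed matrices, which makes
    \<open>c\<close> orthogonal.\<close>
  have Qc: "Q i j = c j i" if "i \<in> R" "j \<in> J" for i j
  proof -
    have "Q i j = (\<Sum>l\<in>R. c j l * (bdot (y i) (a l) * bdot (z i) (a l)))"
      unfolding Q_def using c that by (intro sym_square_combination_contract2) auto
    also have "\<dots> = (\<Sum>l\<in>R. if l = i then c j l else 0)"
      using yz that by (intro sum.cong) auto
    finally show ?thesis using that by simp
  qed
  have orth: "(\<Sum>i\<in>R. c l i * c j i) = (if j = l then 1 else 0)" if "l \<in> J" "j \<in> J" for l j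
  proof -
    have "?B l = (\<Sum>i\<in>R. c l i *s (\<Sum>j\<in>J. c j i *s ?B j))"
      using c[OF that(1)] AQ Qc by simp
    also have "\<dots> = (\<Sum>i\<in>R. \<Sum>j\<in>J. (c l i * c j i) *s ?B j)"
      by (simp add: vec.scale_sum_right)
    also have "\<dots> = (\<Sum>j\<in>J. \<Sum>i\<in>R. (c l i * c j i) *s ?B j)" by (rule sum.swap)
    also have "\<dots> = (\<Sum>j\<in>J. (\<Sum>i\<in>R. c l i * c j i) *s ?B j)"
      by (simp add: vec.scale_sum_left)
    moreover have "?B l = (\<Sum>j\<in>J. (if j = l then 1 else 0) *s ?B j)"
      using that J by (simp add: if_distrib[of "\<lambda>t. t *s _"] cong: if_cong)
    ultimately have "(\<Sum>j\<in>J. ((\<Sum>i\<in>R. c l i * c j i) - (if j = l then 1 else 0)) *s ?B j) = 0"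
      by (simp add: vec.scale_left_diff_distrib sum_subtractf)
    from indB[OF this that(2)] show ?thesis by simp
  qed
  have b_nz: "b j \<noteq> 0" if "j \<in> J" for j
  proof
    assume "b j = 0"
    then have "?B j = 0" by (simp add: sym_square_def vec_eq_iff)
    then have "(\<Sum>l\<in>J. (if l = j then 1 else 0) *s ?B l) = 0" by (intro sum.neutral) auto
    from indB[OF this that] show False by simp
  qed
  show "veronese4 (b j) \<in> (\<lambda>i. veronese4 (a i)) ` R" if j: "j \<in> J"
  proof (rule sym_square_in_span_cases[OF b_nz[OF j] c[OF j]])
    fix i assume i: "i \<in> R" and z: "\<And>l. l \<in> R \<Longrightarrow> l \<noteq> i \<Longrightarrow> c j l = 0"
    \<comment> \<open>Orthogonality leaves only a sign for \<open>c j i\<close>, and fourth powers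
      do not see it.\<close>
    have "(\<Sum>l\<in>R. c j l * c j l) = (\<Sum>l\<in>{i}. c j l * c j l)"
      using i z by (intro sum.mono_neutral_right) auto
    with orth[OF j j] have one: "c j i * c j i = 1" by simp
    have "(\<Sum>l\<in>R. c j l *s ?A l) = (\<Sum>l\<in>{i}. c j l *s ?A l)"
      using i z by (intro sum.mono_neutral_right) auto
    with c[OF j] have "?B j = c j i *s ?A i" by simp
    then have sq: "b j $ p * b j $ q = c j i * (a i $ p * a i $ q)" for p q
      by (metis sym_square_nth vector_smult_component)
    have "veronese4 (b j) $ (p, q, s, t) = veronese4 (a i) $ (p, q, s, t)" for p q s t
    proof -
      have "veronese4 (b j) $ (p, q, s, t) = (b j $ p * b j $ q) * (b j $ s * b j $ t)"
        by (simp add: veronese4_nth)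
      also have "\<dots> = (c j i * c j i) * veronese4 (a i) $ (p, q, s, t)"
        by (simp add: sq veronese4_nth)
      finally show ?thesis by (simp add: one)
    qed
    then have "veronese4 (b j) = veronese4 (a i)" by (auto simp: vec_eq_iff)
    then show ?thesis using i by blast
  next
    assume full: "\<And>i. i \<in> R \<Longrightarrow> c j i \<noteq> 0"
    \<comment> \<open>Row \<open>j\<close> has no zero entry, so a row \<open>l\<close> orthogonal
      to it cannot have a single nonzero entry. Nor can row \<open>l\<close> be a multiple of row
      \<open>j\<close>, since its product with itself is 1.\<close>
    have "card (J - {j}) \<noteq> 0" using cards card_R n_pos j by simp
    then have "J - {j} \<noteq> {}" by (metis card.empty)
    then obtain l where l: "l \<in> J" "l \<noteq> j" by blast
    have lj: "(\<Sum>i\<in>R. c l i * c j i) = 0" using orth[of l j] l j by auto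
    show ?thesis
    proof (rule sym_square_in_span_cases[OF b_nz[OF l(1)] c[OF l(1)]])
      fix i assume i: "i \<in> R" "c l i \<noteq> 0" and z: "\<And>m. m \<in> R \<Longrightarrow> m \<noteq> i \<Longrightarrow> c l m = 0"
      have "(\<Sum>m\<in>R. c l m * c j m) = (\<Sum>m\<in>{i}. c l m * c j m)"
        using i z by (intro sum.mono_neutral_right) auto
      with lj full i show ?thesis by simp
    next
      assume full': "\<And>i. i \<in> R \<Longrightarrow> c l i \<noteq> 0"
      have "\<exists>i\<in>R. c l i \<noteq> t * c j i" for t
      proof (rule ccontr)
        assume "\<not> (\<exists>i\<in>R. c l i \<noteq> t * c j i)"
        then have t: "\<And>i. i \<in> R \<Longrightarrow> c l i = t * c j i" by blast
        have "(\<Sum>i\<in>R. c l i * c l i) = (\<Sum>i\<in>R. t * (c l i * c j i))"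
          using t by (intro sum.cong) (auto simp: mult_ac)
        also have "\<dots> = t * (\<Sum>i\<in>R. c l i * c j i)" by (simp only: sum_distrib_left)
        also have "\<dots> = 0" using lj by simp
        finally show False using orth[OF l(1) l(1)] by simp
      qed
      from tangent_spaces_dependent[OF c[OF j] full c[OF l(1)] full' this]
      obtain v where v: "(\<Sum>i\<in>R. veronese4_differential (a i) (v i)) = 0" "\<And>i. i \<in> R \<Longrightarrow> v i \<noteq> 0"
        by blast
      have "R \<noteq> {}" using card_R by auto
      then show ?thesis using terracini[OF v(1)] v(2) by blast
    qed
  qed
qed

end

section \<open>The three tests\<close>

lemma sum_mset_eq_sum_count:
  fixes M :: "('k::field ^ 'm::finite) multiset"
  assumes "finite F" "set_mset M \<subseteq> F"
  shows "\<Sum>\<^sub># M = (\<Sum>t\<in>F. of_nat (count M t) *s t)"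
  using assms(2)
proof (induction M)
  case (add u M)
  have "(\<Sum>t\<in>F. of_nat (count (add_mset u M) t) *s t) =
      (\<Sum>t\<in>F. of_nat (count M t) *s t + (if t = u then u else 0))"
    by (intro sum.cong) (auto simp: vec.scale_left_distrib)
  then show ?case using add assms(1) by (simp add: sum.distrib)
qed simp

lemma veronese4_scale: "veronese4 (k *s u) = k ^ 4 *s veronese4 u"
  by (auto simp: vec_eq_iff veronese4_nth power4_eq_xxxx)

lemma veronese_tangent_eq_differential: "veronese_tangent u = range (veronese4_differential u)"
  by (auto simp: veronese_tangent_eq veronese4_differential_def)

lemma veronese4_differential_basis:
  "veronese4_differential u v = (\<Sum>t\<in>UNIV. v $ t *s veronese4_differential u (axis t 1))"
proof (subst vec_eq_iff, clarify)
  fix p q s t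
  have e: "(\<Sum>r\<in>UNIV. v $ r * axis r 1 $ p) = v $ p" for p
    by (simp add: axis_def if_distrib[of "\<lambda>t. _ * t"] cong: if_cong)
  have "(\<Sum>r\<in>UNIV. v $ r *s veronese4_differential u (axis r 1)) $ (p, q, s, t) =
     (u $ p * (\<Sum>r\<in>UNIV. v $ r * axis r 1 $ q) + (\<Sum>r\<in>UNIV. v $ r * axis r 1 $ p) * u $ q) * (u $ s * u $ t) +
     (u $ p * u $ q) * (u $ s * (\<Sum>r\<in>UNIV. v $ r * axis r 1 $ t) + (\<Sum>r\<in>UNIV. v $ r * axis r 1 $ s) * u $ t)"
    by (simp only: sum_component vector_smult_component veronese4_differential_nth
        sum_distrib_left sum_distrib_right sum.distrib[symmetric])
      (simp add: algebra_simps)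
  then show "veronese4_differential u v $ (p, q, s, t) =
      (\<Sum>t\<in>UNIV. v $ t *s veronese4_differential u (axis t 1)) $ (p, q, s, t)"
    by (simp only: e veronese4_differential_nth)
qed

text \<open>The derivatives in the coordinate directions, \<open>card R * CARD('n)\<close> in
  number, span all the tangent spaces together. If the dimension reaches this number, they are
  independent.\<close>

lemma tangent_family_independent:
  fixes a :: "'i \<Rightarrow> complex ^ 'n::finite"
  assumes R: "finite R"
    and dim: "card R * CARD('n) \<le> vec.dim (vec.span (\<Union>i\<in>R. veronese_tangent (a i)))"
    and sum: "(\<Sum>i\<in>R. veronese4_differential (a i) (v i)) = 0" and i: "i \<in> R"
  shows "v i = 0"
proof -
  let ?f = "\<lambda>(i, t). veronese4_differential (a i) (axis t 1)" and ?I = "R \<times> (UNIV :: 'n set)"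
  have "veronese4_differential (a i) w \<in> vec.span (?f ` ?I)" if "i \<in> R" for i w
    using that by (subst veronese4_differential_basis)
      (auto intro!: vec.span_sum vec.span_scale intro: vec.span_base)
  then have "vec.span (\<Union>i\<in>R. veronese_tangent (a i)) \<subseteq> vec.span (?f ` ?I)"
    by (intro vec.span_minimal vec.subspace_span) (auto simp: veronese_tangent_eq_differential)
  then have "vec.dim (vec.span (\<Union>i\<in>R. veronese_tangent (a i))) \<le> vec.dim (vec.span (?f ` ?I))"
    by (rule vec.dim_subset)
  then have le: "card ?I \<le> vec.dim (vec.span (?f ` ?I))"
    using dim by (simp add: card_cartesian_product)
  have "(\<Sum>p\<in>?I. v (fst p) $ snd p *s ?f p) =
      (\<Sum>i\<in>R. \<Sum>t\<in>UNIV. v i $ t *s veronese4_differential (a i) (axis t 1))"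
    by (simp add: sum.cartesian_product case_prod_unfold)
  also have "\<dots> = (\<Sum>i\<in>R. veronese4_differential (a i) (v i))"
    by (intro sum.cong refl veronese4_differential_basis[symmetric])
  also have "\<dots> = 0" by fact
  finally have "v (fst (i, t)) $ snd (i, t) = 0" for t
    using family_independent_if_dim[OF _ le, of "\<lambda>p. v (fst p) $ snd p" "(i, t)"] R i by auto
  then show ?thesis by (simp add: vec_eq_iff)
qed

text \<open>Two representatives of the same point have proportional fourth powers.\<close>

lemma proj_point_inj_on:
  assumes R: "finite R"
    and ind: "\<And>x i. (\<Sum>i\<in>R. x i *s veronese4 (a i)) = 0 \<Longrightarrow> i \<in> R \<Longrightarrow> x i = 0"
  shows "inj_on (\<lambda>i. proj_point (a i)) R"
proof (rule inj_onI, rule ccontr)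
  fix i j assume ij: "i \<in> R" "j \<in> R" "proj_point (a i) = proj_point (a j)" "i \<noteq> j"
  then have "a i \<in> vec.span {a j}" unfolding proj_point_def by (metis vec.span_base singletonI)
  then obtain t where "a i = t *s a j" by (auto simp: vec.span_singleton)
  then have v: "veronese4 (a i) = t ^ 4 *s veronese4 (a j)" by (simp add: veronese4_scale)
  let ?x = "\<lambda>l. if l = i then 1 else if l = j then - (t ^ 4) else 0"
  have "(\<Sum>l\<in>R. ?x l *s veronese4 (a l)) = (\<Sum>l\<in>{i, j}. ?x l *s veronese4 (a l))"
    using R ij by (intro sum.mono_neutral_right) auto
  also have "\<dots> = 0" using ij v by simp
  finally show False using ind[of ?x i] ij by simp
qed

text \<open>Injectivity of the point map lets \<open>f\<close> choose exactly the given vectors as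
  representatives, and excludes repeated vectors in \<open>I\<close>.\<close>

lemma general_position_family:
  fixes a :: "'i \<Rightarrow> complex ^ 'n::finite"
  assumes R: "finite R" and nz: "\<And>i. i \<in> R \<Longrightarrow> a i \<noteq> 0"
    and inj: "inj_on (\<lambda>i. proj_point (a i)) R"
    and lgp: "linear_general_position ((\<lambda>i. proj_point (a i)) ` R)"
    and I: "I \<subseteq> R" "card I \<le> CARD('n)" and sum: "(\<Sum>i\<in>I. x i *s a i) = 0" and i: "i \<in> I"
  shows "x i = 0"
proof -
  let ?p = "\<lambda>i. proj_point (a i)"
  have fI: "finite I" using I R finite_subset by blast
  have sub: "?p ` I \<subseteq> ?p ` R" using I(1) by (rule image_mono)
  have "card (?p ` I) \<le> CARD('n)" using card_image_le[OF fI, of ?p] I(2) by linarith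
  moreover have "card (?p ` I) \<le> card (?p ` R)" using sub R by (intro card_mono) auto
  ultimately have "proj_independent (?p ` I)"
    using lgp[unfolded linear_general_position_def, rule_format, OF sub] by simp
  moreover define f where "f P = a (the_inv_into R ?p P)" for P
  have f: "f (?p l) = a l" if "l \<in> I" for l
    using the_inv_into_f_f[OF inj, of l] that I by (auto simp: f_def)
  have "\<forall>P\<in>?p ` I. f P \<in> P \<and> f P \<noteq> 0"
    using f nz I by (auto simp: proj_point_def intro: vec.span_base)
  ultimately have "vec.independent (f ` ?p ` I)" unfolding proj_independent_def by blast
  also have "f ` ?p ` I = a ` I" unfolding image_image by (intro image_cong f refl)
  finally have ind: "vec.independent (a ` I)" .
  have "inj_on a I" using inj I unfolding inj_on_def by (metis subsetD)
  then have "card I \<le> vec.dim (vec.span (a ` I))"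
    using ind by (simp add: vec.dim_eq_card_independent card_image)
  from family_independent_if_dim[OF fI this sum i] show ?thesis .
qed

text \<open>Listing the multiset gives every summand its own index, so that repetitions are
  kept.\<close>

lemma sym_decomposition_family:
  assumes "sym_decomposition M T"
  obtains b :: "nat \<Rightarrow> complex ^ 'n::finite" where
    "M = image_mset (\<lambda>j. veronese4 (b j)) (mset_set {..<size M})"
    "T = (\<Sum>j<size M. veronese4 (b j))"
proof -
  obtain ts where ts: "mset ts = M" using ex_mset by blast
  then have len: "length ts = size M" by auto
  have "\<exists>b. ts ! j = veronese4 b" if "j < length ts" for j
  proof -
    have "ts ! j \<in># M" using that ts by (metis nth_mem set_mset_mset)
    then show ?thesis using assms by (auto simp: sym_decomposition_def sym_rank1_tensors_def)
  qed
  then obtain b where b: "\<And>j. j < length ts \<Longrightarrow> ts ! j = veronese4 (b j)"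
    using choice[of "\<lambda>j b. j < length ts \<longrightarrow> ts ! j = veronese4 b"] by blast
  have "M = mset (map ((!) ts) [0..<length ts])" by (simp add: map_nth ts)
  also have "\<dots> = image_mset ((!) ts) (mset_set {..<length ts})"
    by (simp add: mset_map lessThan_atLeast0 flip: mset_upt)
  also have "\<dots> = image_mset (\<lambda>j. veronese4 (b j)) (mset_set {..<size M})"
    unfolding len[symmetric] by (intro image_mset_cong) (simp add: b)
  finally have M: "M = image_mset (\<lambda>j. veronese4 (b j)) (mset_set {..<size M})" .
  moreover have "T = (\<Sum>j<size M. veronese4 (b j))"
    using assms arg_cong[OF M, of sum_mset] by (simp add: sym_decomposition_def sum_unfold_sum_mset)
  ultimately show ?thesis by (rule that)
qed

theorem mainTheorem6:
  fixes n r :: nat and m :: "nat \<Rightarrow> complex ^ 'n::finite" and T :: "'n tensor4"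
  assumes "n \<ge> 1"
    and "CARD('n) = n + 1"
    and "r = 2 * n + 1"
    and "\<forall>i\<in>{1..r}. m i \<noteq> 0"
    and "T = (\<Sum>i = 1..r. veronese4 (m i))"
    and minimality: "vec.dim (vec.span {veronese4 (m i) | i. i \<in> {1..r}}) = r"
    and Kruskal: "linear_general_position {proj_point (m i) | i. i \<in> {1..r}}"
    and Terracini: "vec.dim (vec.span (\<Union>i\<in>{1..r}. veronese_tangent (m i))) = 2 * n^2 + 3 * n + 1"
  shows "sym_rank T = r \<and> identifiable T \<and>
    (\<forall>S. (finite S \<and> card S = r \<and> S \<subseteq> sym_rank1_tensors \<and> \<Sum>S = T) \<longleftrightarrow>
         S = {veronese4 (m i) | i. i \<in> {1..r}})"
proof -
  let ?V = "\<lambda>i. veronese4 (m i)"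
  define F where "F = ?V ` {1..r}"
  have F_eq: "{veronese4 (m i) | i. i \<in> {1..r}} = F" by (auto simp: F_def)
  have finF: "finite F" by (simp add: F_def)
  have indV: "x i = 0" if "(\<Sum>i\<in>{1..r}. x i *s ?V i) = 0" "i \<in> {1..r}" for x i
    using family_independent_if_dim[of "{1..r}" ?V x i] that minimality
    unfolding F_eq by (simp add: F_def)
  have inj_proj: "inj_on (\<lambda>i. proj_point (m i)) {1..r}"
    using indV by (intro proj_point_inj_on) auto
  have "card F \<ge> r"
    using minimality vec.dim_le_card[of F F] finF unfolding F_eq by (simp add: vec.span_superset)
  then have cardF: "card F = r" using card_image_le[of "{1..r}" ?V] by (simp add: F_def)
  then have injV: "inj_on ?V {1..r}" by (simp add: F_def eq_card_imp_inj_on)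
  have sumF: "\<Sum>F = T" using injV assms(5) by (simp add: F_def sum.reindex)
  have lgp: "linear_general_position ((\<lambda>i. proj_point (m i)) ` {1..r})"
    using Kruskal by (simp only: setcompr_eq_image Collect_mem_eq)
  \<comment> \<open>The number in Terracini's test is \<open>(2 * n + 1) * (n + 1)\<close>, the
    largest possible dimension.\<close>
  have "card {1..r} * CARD('n) \<le> vec.dim (vec.span (\<Union>i\<in>{1..r}. veronese_tangent (m i)))"
    using assms(2,3) Terracini by (simp add: power2_eq_square algebra_simps)
  note terracini = tangent_family_independent[OF _ this]
  interpret points_in_general_position m "{1..r}" n
    by unfold_locales
      (use assms general_position_family[OF _ _ inj_proj lgp] in auto)
  have F_rank1: "F \<subseteq> sym_rank1_tensors"
  proof
    fix t assume "t \<in> F"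
    then obtain i where i: "i \<in> {1..r}" "t = ?V i" by (auto simp: F_def)
    have "t \<noteq> 0"
    proof
      assume "t = 0"
      then have "(\<Sum>l\<in>{1..r}. (if l = i then 1 else 0) *s ?V l) = 0"
        using i by (intro sum.neutral) auto
      from indV[OF this i(1)] show False by simp
    qed
    then show "t \<in> sym_rank1_tensors" using i by (auto simp: sym_rank1_tensors_def)
  qed
  have dec: "sym_decomposition (mset_set F) T" "size (mset_set F) = r"
    using F_rank1 finF sumF cardF by (auto simp: sym_decomposition_def sum_unfold_sum_mset)
  have unique: "M = mset_set F" if M: "sym_decomposition M T" "size M \<le> r" for M
  proof -
    obtain b where b: "M = image_mset (\<lambda>j. veronese4 (b j)) (mset_set {..<size M})"
      "T = (\<Sum>j<size M. veronese4 (b j))"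
      using sym_decomposition_family[OF M(1)] .
    have "veronese4 (b j) \<in> F" if "j < size M" for j
      unfolding F_def
      by (rule decomposition_unique(2)[of "{..<size M}" b])
        (use that M b assms(5) terracini in auto)
    moreover have "set_mset M = (\<lambda>j. veronese4 (b j)) ` {..<size M}"
      using arg_cong[OF b(1), of set_mset] by simp
    ultimately have MF: "set_mset M \<subseteq> F" by auto
    \<comment> \<open>Multiplicities could still differ. Comparing the two sums gives a relation
      with coefficients \<open>count - 1\<close> among independent tensors.\<close>
    have "(\<Sum>t\<in>F. of_nat (count M t) *s t) = \<Sum>F"
      using sum_mset_eq_sum_count[OF finF MF] M(1) sumF by (simp add: sym_decomposition_def)
    then have "(\<Sum>i\<in>{1..r}. (of_nat (count M (?V i)) - 1) *s ?V i) = 0"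
      using injV by (simp add: F_def sum.reindex vec.scale_left_diff_distrib sum_subtractf)
    then have "of_nat (count M (?V i)) - 1 = (0::complex)" if "i \<in> {1..r}" for i
      using indV[of "\<lambda>i. of_nat (count M (?V i)) - 1" i] that by blast
    then have "count M t = 1" if "t \<in> F" for t
      using that by (auto simp: F_def)
    then show ?thesis using MF finF
      by (intro multiset_eqI) (auto simp: count_mset_set' not_in_iff)
  qed
  have rank: "sym_rank T = r"
    unfolding sym_rank_def
  proof (rule Least_equality)
    show "\<exists>M. sym_decomposition M T \<and> size M = r" using dec by blast
    fix k assume "\<exists>M. sym_decomposition M T \<and> size M = k"
    then obtain M where M: "sym_decomposition M T" "size M = k" by blast
    show "r \<le> k"
    proof (cases "k \<le> r")
      case True
      then have "M = mset_set F" using M by (intro unique) auto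
      then show ?thesis using M(2) dec(2) by simp
    qed simp
  qed
  have "identifiable T"
    unfolding identifiable_def rank
  proof (rule ex1I[of _ "mset_set F"])
    show "sym_decomposition (mset_set F) T \<and> size (mset_set F) = r" using dec by blast
    show "M = mset_set F" if "sym_decomposition M T \<and> size M = r" for M
      using that by (intro unique) auto
  qed
  moreover have "(finite S \<and> card S = r \<and> S \<subseteq> sym_rank1_tensors \<and> \<Sum>S = T) \<longleftrightarrow> S = F" for S
  proof
    assume S: "finite S \<and> card S = r \<and> S \<subseteq> sym_rank1_tensors \<and> \<Sum>S = T"
    then have "mset_set S = mset_set F"
      by (intro unique) (auto simp: sym_decomposition_def sum_unfold_sum_mset)
    then have "set_mset (mset_set S) = set_mset (mset_set F)" by (rule arg_cong)
    then show "S = F" using S finF by simp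
  next
    assume "S = F"
    then show "finite S \<and> card S = r \<and> S \<subseteq> sym_rank1_tensors \<and> \<Sum>S = T"
      using finF cardF F_rank1 sumF by simp
  qed
  ultimately show ?thesis using rank by (simp only: F_eq simp_thms)
qed

end
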